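(* Let $\lambda>0$, $\beta\in(0,1)$ and $|\rho|<1$. Let $\epsilon$ be the error term, with Laplace transform $$\mathbb{E}\left(e^{-s\epsilon}\right)=\exp\left\{(\rho s+\lambda)^\beta-(s+\lambda)^\beta\right\},$$ of the stationary autoregressive model $X_n=\rho X_{n-1}+\epsilon_n$ with positive tempered stable marginals. Then the distribution of $\epsilon$ is infinitely divisible.
   Context: In the model $X_n=\rho X_{n-1}+\epsilon_n$, the $\epsilon_n$ are i.i.d. (distributed as $\epsilon$), $\epsilon_n$ is independent of $X_{n-1}$, and the stationary marginals are positive tempered stable with tempering parameter $\lambda$ and stability index $\beta$, i.e. $\mathbb{E}(e^{-sX_n})=e^{-((s+\lambda)^\beta-\lambda^\beta)}$. *)

theory Defs
  imports "HOL-Probability.Probability"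
begin

definition laplace_transform :: "real measure \<Rightarrow> real \<Rightarrow> real" where
  "laplace_transform \<mu> s = (\<integral>x. exp (- s * x) \<partial>\<mu>)"

text \<open>
  A law on the positive half-line with tempering parameter \<open>lam\<close> and stability index \<open>\<beta>\<close>.
  The Bochner integral of a non-integrable function is 0, so an equation with the (positive)
  right-hand side below includes the finiteness of the expectation.
\<close>

definition positive_tempered_stable :: "real \<Rightarrow> real \<Rightarrow> real measure \<Rightarrow> bool" where
  "positive_tempered_stable lam \<beta> \<mu> \<longleftrightarrow>
     prob_space \<mu> \<and> sets \<mu> = sets borel \<and> (AE x in \<mu>. 0 < x) \<and>
     (\<forall>s\<ge>0. laplace_transform \<mu> s = exp (- ((s + lam) powr \<beta> - lam powr \<beta>)))"

text \<open>
  Time is indexed by the natural numbers: \<open>X 0\<close> is the initial value and the innovations are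
  \<open>eps 1, eps 2, \<dots>\<close>; \<open>eps 0\<close> plays no role. The parameter \<open>\<nu>\<close> is the law of the error term.
\<close>

locale stationary_AR1 = prob_space M
  for M :: "'a measure" +
  fixes \<rho> :: real
    and X :: "nat \<Rightarrow> 'a \<Rightarrow> real"
    and eps :: "nat \<Rightarrow> 'a \<Rightarrow> real"
    and \<nu> :: "real measure"
  assumes X_measurable: "\<And>n. random_variable borel (X n)"
    and recursion: "\<And>n. AE \<omega> in M. X (Suc n) \<omega> = \<rho> * X n \<omega> + eps (Suc n) \<omega>"
    and eps_indep: "indep_vars (\<lambda>_. borel) eps {1..}"
    and eps_law: "\<And>n. n \<ge> 1 \<Longrightarrow> distr M borel (eps n) = \<nu>"
    and eps_indep_past: "\<And>n. indep_var borel (eps (Suc n)) borel (X n)"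
    and strictly_stationary:
      "distr M (\<Pi>\<^sub>M n\<in>UNIV. borel) (\<lambda>\<omega> n. X (Suc n) \<omega>) =
       distr M (\<Pi>\<^sub>M n\<in>UNIV. borel) (\<lambda>\<omega> n. X n \<omega>)"

primrec convolution_power :: "real measure \<Rightarrow> nat \<Rightarrow> real measure" where
  "convolution_power \<mu> 0 = return borel 0"
| "convolution_power \<mu> (Suc n) = (\<mu> \<star> convolution_power \<mu> n)"

definition infinitely_divisible :: "real measure \<Rightarrow> bool" where
  "infinitely_divisible \<mu> \<longleftrightarrow>
     prob_space \<mu> \<and> sets \<mu> = sets borel \<and>
     (\<forall>n\<ge>1. \<exists>\<kappa>. prob_space \<kappa> \<and> sets \<kappa> = sets borel \<and> convolution_power \<kappa> n = \<mu>)"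

end

theory Submission
  imports Defs "HOL-Real_Asymp.Real_Asymp"
begin

text \<open>
  For \<open>0 \<le> \<rho> < 1\<close> the error law is a subordinator law: its Laplace exponent
  \<open>(s + lam) powr \<beta> - (\<rho> * s + lam) powr \<beta>\<close> is the integral of \<open>(1 - exp (- s * x)) * l x\<close> over
  \<open>x > 0\<close>, where \<open>l\<close> is the Levy density of the tempered stable law minus that of \<open>\<rho>\<close> times a
  tempered stable variable (\<open>has_bochner_integral_error_Levy_density\<close>). This difference is
  nonnegative, which expresses that tempered stable laws are self-decomposable. Then \<open>l / n\<close> is
  also a Levy density, and the law that belongs to it is an \<open>n\<close>-th convolution root.

  That every Levy density \<open>l\<close> belongs to a law is \<open>exists_law_with_Levy_density\<close>. Cut off the small
  jumps so that the remaining mass is at most \<open>k\<close>, spread this mass, divided by \<open>k\<close>, over the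
  positive half-line and put the rest of a unit mass at 0. The \<open>k\<close>-th convolution power of the
  resulting law has Laplace transform \<open>(1 - a k s / k) ^ k\<close>, where \<open>a k s\<close> tends to the desired
  exponent. A continuity theorem for Laplace transforms (\<open>laplace_continuity\<close>), which rests on
  Helly's selection theorem, gives the limit law; the uniqueness theorem
  (\<open>eq_of_laplace_transform_eq\<close>) identifies its convolution powers with the given law.

  Negative \<open>\<rho>\<close> does not occur (\<open>nonneg_of_error_laplace_transform\<close>): a Laplace transform is convex
  where it is finite, but for \<open>\<rho> < 0\<close> the stated one would have slope \<open>- \<infinity>\<close> at the right
  end point \<open>lam / - \<rho>\<close> of the interval on which the formula makes sense.
\<close>

section \<open>Laplace transforms of laws on the line\<close>

text \<open>
  Extended nonnegative integrals let the multiplicativity of Laplace transforms be proved without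
  integrability conditions: where an expectation is infinite, both \<open>laplace_transform\<close> and
  \<open>enn2real\<close> give 0.
\<close>

lemma laplace_transform_eq_nn_integral:
  assumes [measurable_cong]: "sets \<mu> = sets borel"
  shows "laplace_transform \<mu> s = enn2real (\<integral>\<^sup>+x. ennreal (exp (- s * x)) \<partial>\<mu>)"
  unfolding laplace_transform_def by (intro integral_eq_nn_integral) auto

lemma laplace_transform_convolution:
  assumes "finite_measure \<mu>" "finite_measure \<kappa>"
    and [measurable_cong]: "sets \<mu> = sets borel" "sets \<kappa> = sets borel"
  shows "laplace_transform (\<mu> \<star> \<kappa>) s = laplace_transform \<mu> s * laplace_transform \<kappa> s"
proof -
  have "(\<integral>\<^sup>+z. ennreal (exp (- s * z)) \<partial>(\<mu> \<star> \<kappa>))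
      = (\<integral>\<^sup>+x. \<integral>\<^sup>+y. ennreal (exp (- s * (x + y))) \<partial>\<kappa> \<partial>\<mu>)"
    using assms by (intro nn_integral_convolution) auto
  also have "\<dots> = (\<integral>\<^sup>+x. \<integral>\<^sup>+y. ennreal (exp (- s * x)) * ennreal (exp (- s * y)) \<partial>\<kappa> \<partial>\<mu>)"
    by (intro nn_integral_cong) (simp add: ennreal_mult' [symmetric] exp_add [symmetric] algebra_simps)
  also have "\<dots> = (\<integral>\<^sup>+x. ennreal (exp (- s * x)) \<partial>\<mu>) * (\<integral>\<^sup>+y. ennreal (exp (- s * y)) \<partial>\<kappa>)"
    by (simp add: nn_integral_cmult nn_integral_multc)
  finally show ?thesis
    using assms(3,4) by (simp add: laplace_transform_eq_nn_integral enn2real_mult)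
qed

lemma prob_space_convolution:
  assumes "prob_space \<mu>" "prob_space \<kappa>"
    and [measurable_cong]: "sets \<mu> = sets borel" "sets \<kappa> = sets borel"
  shows "prob_space (\<mu> \<star> (\<kappa> :: real measure))"
proof -
  interpret pair_prob_space \<mu> \<kappa>
    using assms by (simp add: pair_prob_space_def pair_sigma_finite_def prob_space_imp_sigma_finite)
  show ?thesis
    unfolding convolution_def by (intro prob_space_distr) measurable
qed

lemma convolution_power_prob_space:
  assumes "prob_space \<mu>" "sets \<mu> = sets borel"
  shows "prob_space (convolution_power \<mu> n)" "sets (convolution_power \<mu> n) = sets borel"
proof (induction n)
  case 0
  show "prob_space (convolution_power \<mu> 0)" "sets (convolution_power \<mu> 0) = sets borel"
    by (simp_all add: prob_space_return)
next
  case (Suc n)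
  then show "prob_space (convolution_power \<mu> (Suc n))"
      "sets (convolution_power \<mu> (Suc n)) = sets borel"
    using assms by (simp_all add: prob_space_convolution)
qed

lemma laplace_transform_convolution_power:
  assumes "prob_space \<mu>" "sets \<mu> = sets borel"
  shows "laplace_transform (convolution_power \<mu> n) s = laplace_transform \<mu> s ^ n"
proof (induction n)
  case 0
  have "laplace_transform (return borel 0) s = exp (- s * 0)"
    unfolding laplace_transform_def by (rule integral_return) auto
  then show ?case by simp
next
  case (Suc n)
  then show ?case
    using assms convolution_power_prob_space[OF assms, of n]
    by (simp add: laplace_transform_convolution prob_space_def)
qed

lemma integrable_exp_neg:
  assumes "prob_space \<mu>" and [measurable_cong]: "sets \<mu> = sets borel"
    and "AE x in \<mu>. 0 \<le> x" "s \<ge> (0::real)"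
  shows "integrable \<mu> (\<lambda>x. exp (- s * x))"
proof -
  interpret prob_space \<mu> by fact
  show ?thesis
    using assms(3,4) by (intro integrable_const_bound[where B = 1]) (auto elim!: eventually_mono)
qed

lemma laplace_transform_bounds:
  assumes "prob_space \<mu>" and [measurable_cong]: "sets \<mu> = sets borel"
    and "AE x in \<mu>. 0 \<le> x" "s \<ge> (0::real)"
  shows "0 < laplace_transform \<mu> s" "laplace_transform \<mu> s \<le> 1"
proof -
  interpret prob_space \<mu> by fact
  note int = integrable_exp_neg[OF assms]
  have "laplace_transform \<mu> s \<le> (\<integral>x. 1 \<partial>\<mu>)"
    unfolding laplace_transform_def using assms(3,4) int
    by (intro integral_mono_AE) (auto elim!: eventually_mono)
  then show "laplace_transform \<mu> s \<le> 1" by (simp add: prob_space)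
  show "0 < laplace_transform \<mu> s"
  proof -
    have "laplace_transform \<mu> s \<noteq> 0"
      unfolding laplace_transform_def
      using integral_nonneg_eq_0_iff_AE[OF int] by (simp add: AE_False)
    moreover have "0 \<le> laplace_transform \<mu> s"
      unfolding laplace_transform_def by (rule integral_nonneg_AE) auto
    ultimately show ?thesis by simp
  qed
qed

text \<open>
  Mass below \<open>- a < 0\<close> would make the Laplace transform grow at least like a multiple of
  \<open>exp (s * a)\<close>. In this way the support of convolution powers and of the error law is read off
  from their Laplace transforms. The lower bound 0 excludes an infinite expectation, which
  \<open>laplace_transform\<close> represents by 0.
\<close>

lemma AE_nonneg_of_laplace_transform_le_1:
  assumes "prob_space \<mu>" and [measurable_cong]: "sets \<mu> = sets borel"
    and L: "\<And>s. s \<ge> 0 \<Longrightarrow> 0 < laplace_transform \<mu> s" "\<And>s. s \<ge> 0 \<Longrightarrow> laplace_transform \<mu> s \<le> 1"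
  shows "AE x in \<mu>. (0::real) \<le> x"
proof -
  interpret prob_space \<mu> by fact
  have "AE x in \<mu>. - (1 / real (Suc m)) < x" for m
  proof -
    define a where "a = 1 / real (Suc m)"
    have a: "a > 0" by (simp add: a_def)
    have bound: "prob {x \<in> space \<mu>. x \<le> - a} \<le> exp (- s * a)" if s: "s \<ge> 0" for s
    proof -
      have int: "integrable \<mu> (\<lambda>x. exp (- s * x))"
        using L(1)[OF s] unfolding laplace_transform_def
        using not_integrable_integral_eq by fastforce
      have "prob {x \<in> space \<mu>. x \<le> - a} = (\<integral>x. indicator {x \<in> space \<mu>. x \<le> - a} x \<partial>\<mu>)"
        by simp
      also have "\<dots> \<le> (\<integral>x. exp (- s * a) * exp (- s * x) \<partial>\<mu>)"
      proof (intro integral_mono)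
        fix x
        show "indicator {x \<in> space \<mu>. x \<le> - a} x \<le> exp (- s * a) * exp (- s * x)"
        proof (cases "x \<le> -a")
          case True
          then have "s * a \<le> s * (- x)" using s by (intro mult_left_mono) auto
          then show ?thesis by (auto simp: exp_add [symmetric] indicator_def)
        qed (simp add: indicator_def)
      qed (use int in \<open>simp_all add: integrable_indicator_iff less_top [symmetric]\<close>)
      also have "\<dots> = exp (- s * a) * laplace_transform \<mu> s"
        by (simp add: laplace_transform_def)
      also have "\<dots> \<le> exp (- s * a)" using L(2)[OF s] by simp
      finally show ?thesis .
    qed
    have "((\<lambda>s. exp (- s * a)) \<longlongrightarrow> 0) at_top"
      using a by real_asymp
    then have "prob {x \<in> space \<mu>. x \<le> - a} \<le> 0"
      by (rule tendsto_lowerbound) (use eventually_mono[OF eventually_ge_at_top bound] in simp_all)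
    then have "prob {x \<in> space \<mu>. x \<le> - a} = 0"
      by (simp add: measure_le_0_iff)
    then have "AE x in \<mu>. \<not> x \<le> - a"
      by (subst (asm) prob_eq_0) auto
    then show ?thesis by (auto simp: a_def elim!: eventually_mono)
  qed
  then have "AE x in \<mu>. \<forall>m. - (1 / real (Suc m)) < x"
    by (simp add: AE_all_countable)
  then show ?thesis
  proof (eventually_elim)
    case (elim x)
    show "0 \<le> x"
    proof (rule ccontr)
      assume "\<not> 0 \<le> x"
      then obtain m where "1 / real (Suc m) < - x"
        using reals_Archimedean[of "-x"] by (auto simp: inverse_eq_divide)
      with elim show False by (metis less_minus_iff not_less_iff_gr_or_eq order.strict_trans)
    qed
  qed
qed

section \<open>Uniqueness\<close>

text \<open>
  On \<open>[0, 1]\<close> all moments are at most 1, so the power series of the characteristic function may be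
  integrated term by term; hence the moments determine the characteristic function.
\<close>

lemma real_distribution_eq_of_moments:
  assumes M: "real_distribution M" and N: "real_distribution N"
    and unit: "AE y in M. 0 \<le> y \<and> y \<le> 1" "AE y in N. 0 \<le> y \<and> y \<le> 1"
    and moments: "\<And>k. (\<integral>y. y ^ k \<partial>M) = (\<integral>y. y ^ k \<partial>N)"
  shows "M = N"
proof -
  have char_series: "char P t = (\<Sum>k. (\<i> * of_real t) ^ k / fact k * of_real (\<integral>y. y ^ k \<partial>P))"
    if P: "real_distribution P" and P1: "AE y in P. 0 \<le> y \<and> y \<le> 1" for P t
  proof -
    interpret P: real_distribution P by fact
    let ?f = "\<lambda>k y. (\<i> * of_real t) ^ k / fact k * of_real (y ^ k) :: complex"
    have pow: "AE y in P. norm (y ^ k) \<le> 1" for k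
      using P1 by eventually_elim (simp add: power_le_one)
    have int: "integrable P (\<lambda>y. y ^ k)" for k
      using pow by (intro P.integrable_const_bound[where B = 1]) auto
    have norm_f: "norm (?f k y) = \<bar>t\<bar> ^ k / fact k * norm (y ^ k)" for k y
      by (simp add: norm_mult norm_divide norm_power power_abs)
    have summ: "summable (\<lambda>k. \<bar>t\<bar> ^ k / fact k)"
      using summable_exp[of "\<bar>t\<bar>"] by (simp add: field_simps)
    have "char P t = (\<integral>y. (\<Sum>k. ?f k y) \<partial>P)"
      unfolding char_def
    proof (intro Bochner_Integration.integral_cong refl)
      fix y
      have "(\<lambda>k. (\<i> * of_real (t * y)) ^ k /\<^sub>R fact k) sums exp (\<i> * of_real (t * y))"
        by (rule exp_converges)
      moreover have "(\<i> * of_real (t * y)) ^ k /\<^sub>R fact k = ?f k y" for k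
        by (simp add: scaleR_conv_of_real power_mult_distrib field_simps)
      ultimately show "iexp (t * y) = (\<Sum>k. ?f k y)"
        by (simp add: sums_iff)
    qed
    also have "\<dots> = (\<Sum>k. \<integral>y. ?f k y \<partial>P)"
    proof (rule integral_suminf)
      show "integrable P (?f k)" for k
        using int by (intro integrable_mult_right integrable_of_real) auto
      have "AE y in P. \<forall>k. norm (y ^ k) \<le> 1"
        using pow by (simp add: AE_all_countable)
      then show "AE y in P. summable (\<lambda>k. norm (?f k y))"
      proof eventually_elim
        case (elim y)
        show ?case
          by (rule summable_comparison_test'[OF summ, of 0])
            (use elim in \<open>simp only: real_norm_def abs_norm_cancel norm_f, auto intro!: divide_right_mono mult_left_le\<close>)
      qed
      have "(\<integral>y. norm (?f k y) \<partial>P) \<le> \<bar>t\<bar> ^ k / fact k" for k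
      proof -
        have "(\<integral>y. norm (?f k y) \<partial>P) = \<bar>t\<bar> ^ k / fact k * (\<integral>y. norm (y ^ k) \<partial>P)"
          unfolding norm_f by simp
        also have "\<dots> \<le> \<bar>t\<bar> ^ k / fact k * 1"
          using P.integral_le_const[of "\<lambda>y. norm (y ^ k)" 1] pow int
          by (intro mult_left_mono) auto
        finally show ?thesis by (simp only: mult_1_right)
      qed
      then show "summable (\<lambda>k. \<integral>y. norm (?f k y) \<partial>P)"
        by (intro summable_comparison_test'[OF summ, of 0]) simp
    qed
    also have "\<dots> = (\<Sum>k. (\<i> * of_real t) ^ k / fact k * of_real (\<integral>y. y ^ k \<partial>P))"
      by (simp del: of_real_power)
    finally show ?thesis .
  qed
  have "char M = char N"
    using char_series[OF M unit(1)] char_series[OF N unit(2)] moments by (intro ext) simp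
  then show ?thesis by (rule Levy_uniqueness[OF M N])
qed

text \<open>
  Under \<open>x \<mapsto> exp (- x)\<close> laws on the half-line become laws on \<open>[0, 1]\<close>, and the Laplace
  transforms at the natural numbers become the moments.
\<close>

lemma eq_of_laplace_transform_eq:
  assumes \<mu>: "prob_space \<mu>" "sets \<mu> = sets borel" "AE x in \<mu>. 0 \<le> x"
    and \<kappa>: "prob_space \<kappa>" "sets \<kappa> = sets borel" "AE x in \<kappa>. 0 \<le> x"
    and L: "\<And>k::nat. laplace_transform \<mu> (real k) = laplace_transform \<kappa> (real k)"
  shows "\<mu> = \<kappa>"
proof -
  let ?E = "\<lambda>P. distr P borel (\<lambda>x::real. exp (- x))"
  have dist: "real_distribution (?E P)" and unit: "AE y in ?E P. 0 \<le> y \<and> y \<le> 1"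
    and mom: "(\<integral>y. y ^ k \<partial>?E P) = laplace_transform P (real k)"
    and inv: "distr (?E P) borel (\<lambda>y. - ln y) = P"
    if P: "prob_space P" "sets P = sets borel" "AE x in P. 0 \<le> x" for P k
  proof -
    note [measurable_cong] = P(2)
    interpret prob_space P by fact
    show "real_distribution (?E P)"
      by (simp add: real_distribution_def real_distribution_axioms_def prob_space_distr)
    show "AE y in ?E P. 0 \<le> y \<and> y \<le> 1"
      using P(3) by (subst AE_distr_iff) (auto elim!: eventually_mono)
    show "(\<integral>y. y ^ k \<partial>?E P) = laplace_transform P (real k)"
      by (subst integral_distr)
        (auto simp: laplace_transform_def exp_of_nat_mult [symmetric] simp del: exp_minus)
    have "distr (?E P) borel (\<lambda>y. - ln y) = distr P borel (\<lambda>x. x)"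
      by (subst distr_distr) (auto simp: o_def)
    also have "\<dots> = P" using P(2) by (intro distr_id2) simp
    finally show "distr (?E P) borel (\<lambda>y. - ln y) = P" .
  qed
  have "?E \<mu> = ?E \<kappa>"
    by (rule real_distribution_eq_of_moments)
      (use dist[OF \<mu>] dist[OF \<kappa>] unit[OF \<mu>] unit[OF \<kappa>] mom[OF \<mu>] mom[OF \<kappa>] L in auto)
  then show ?thesis using inv[OF \<mu>] inv[OF \<kappa>] by metis
qed

section \<open>Continuity theorem\<close>

text \<open>
  By Markov's inequality applied to \<open>1 - exp (- s * x)\<close> at \<open>s = 1 / b\<close>, the mass beyond \<open>b\<close> is at
  most \<open>\<psi> (1 / b) / (1 - exp (- 1))\<close>, uniformly in the family.
\<close>

lemma tight_of_laplace_transform_lower_bound: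
  assumes \<mu>: "\<And>k. prob_space (\<mu> k)" "\<And>k. sets (\<mu> k) = sets borel" "\<And>k. AE x in \<mu> k. 0 \<le> x"
    and lower: "\<And>k s. s \<ge> 0 \<Longrightarrow> 1 - \<psi> s \<le> laplace_transform (\<mu> k) s"
    and \<psi>: "(\<lambda>m. \<psi> (1 / real (Suc m))) \<longlonglongrightarrow> 0"
  shows "tight \<mu>"
  unfolding tight_def
proof (intro conjI allI impI)
  show "real_distribution (\<mu> k)" for k
    using \<mu> by (simp add: real_distribution_def real_distribution_axioms_def)
next
  fix \<epsilon> :: real assume \<epsilon>: "\<epsilon> > 0"
  \<comment> \<open>The value of \<open>1 - exp (- s * x)\<close> at \<open>x = 1 / s\<close>, and so a lower bound for it beyond.\<close>
  define c where "c = 1 - exp (- 1 :: real)"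
  have c: "c > 0" by (simp add: c_def)
  have "\<forall>\<^sub>F m in sequentially. \<psi> (1 / real (Suc m)) < \<epsilon> * c"
    using \<epsilon> c by (intro order_tendstoD(2)[OF \<psi>]) simp
  then obtain m where m: "\<psi> (1 / real (Suc m)) < \<epsilon> * c"
    by (auto simp: eventually_sequentially)
  define s where "s = 1 / real (Suc m)"
  define b where "b = real (Suc m)"
  have s: "s > 0" "s * b = 1" by (simp_all add: s_def b_def)
  have b: "b > 0" by (simp add: b_def)
  \<comment> \<open>The left end point \<open>-1\<close> keeps a possible atom at 0 inside the half-open interval.\<close>
  have "measure (\<mu> k) {-1 <.. b} > 1 - \<epsilon>" for k
  proof -
    note [measurable_cong] = \<mu>(2)[of k]
    interpret prob_space "\<mu> k" by (rule \<mu>)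
    have sp: "space (\<mu> k) = UNIV" using sets_eq_imp_space_eq[OF \<mu>(2)[of k]] by simp
    have int: "integrable (\<mu> k) (\<lambda>x. exp (- s * x))"
      using s by (intro integrable_exp_neg[OF \<mu>]) simp
    have "c * measure (\<mu> k) (- {-1 <.. b}) = (\<integral>x. c * indicator (- {-1 <.. b}) x \<partial>\<mu> k)"
      using sp by simp
    also have "\<dots> \<le> (\<integral>x. 1 - exp (- s * x) \<partial>\<mu> k)"
    proof (rule integral_mono_AE)
      show "integrable (\<mu> k) (\<lambda>x. c * indicator (- {- 1<..b}) x)"
        by (simp add: integrable_indicator_iff less_top [symmetric])
      show "integrable (\<mu> k) (\<lambda>x. 1 - exp (- s * x))"
        using int by simp
      show "AE x in \<mu> k. c * indicator (- {- 1<..b}) x \<le> 1 - exp (- s * x)"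
        using \<mu>(3)[of k]
      proof eventually_elim
        case (elim x)
        show ?case
        proof (cases "x \<le> b")
          case True
          then have "x \<in> {-1 <.. b}" using elim by simp
          then show ?thesis using elim s by simp
        next
          case False
          then have "s * b \<le> s * x" using s by (intro mult_left_mono) auto
          then have "exp (- s * x) \<le> exp (- 1)" using s by simp
          then show ?thesis by (auto simp: c_def indicator_def)
        qed
      qed
    qed
    also have "\<dots> = 1 - laplace_transform (\<mu> k) s"
      using int by (simp add: laplace_transform_def prob_space)
    also have "\<dots> \<le> \<psi> s" using lower[of s k] s by simp
    also have "\<dots> < \<epsilon> * c" using m by (simp add: s_def)
    finally have "measure (\<mu> k) (- {-1 <.. b}) < \<epsilon>" using c by (simp add: mult.commute)
    moreover have "measure (\<mu> k) (- {-1 <.. b}) = 1 - measure (\<mu> k) {-1 <.. b}"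
      using prob_compl[of "{-1 <.. b}"] sp by (simp add: Compl_eq_Diff_UNIV)
    ultimately show ?thesis by simp
  qed
  then show "\<exists>a b. a < b \<and> (\<forall>n. 1 - \<epsilon> < measure (\<mu> n) {a<..b})"
    using b by (intro exI[of _ "-1"] exI[of _ b]) auto
qed

text \<open>
  Helly's theorem provides a weak limit along a subsequence. The functions \<open>exp (- s * x)\<close> are
  unbounded on the line; replacing \<open>x\<close> by \<open>max 0 x\<close> makes them bounded and continuous and changes
  nothing on the half-line. Pushing the limit forward under \<open>max 0\<close> gives a law on the
  half-line at once.
\<close>

lemma laplace_continuity:
  assumes \<mu>: "\<And>k. prob_space (\<mu> k)" "\<And>k. sets (\<mu> k) = sets borel" "\<And>k. AE x in \<mu> k. 0 \<le> x"
    and lower: "\<And>k s. s \<ge> 0 \<Longrightarrow> 1 - \<psi> s \<le> laplace_transform (\<mu> k) s"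
    and \<psi>: "(\<lambda>m. \<psi> (1 / real (Suc m))) \<longlonglongrightarrow> 0"
    and lim: "\<And>s. s \<ge> 0 \<Longrightarrow> (\<lambda>k. laplace_transform (\<mu> k) s) \<longlonglongrightarrow> \<phi> s"
  obtains \<kappa> where "prob_space \<kappa>" "sets \<kappa> = sets borel" "AE x in \<kappa>. 0 \<le> x"
    "\<And>s. s \<ge> 0 \<Longrightarrow> laplace_transform \<kappa> s = \<phi> s"
proof -
  have "tight \<mu>"
    by (rule tight_of_laplace_transform_lower_bound[OF \<mu> lower \<psi>])
  from tight_imp_convergent_subsubsequence[OF this strict_mono_id]
  obtain r M where r: "strict_mono (r :: nat \<Rightarrow> nat)" and M: "real_distribution M"
    and conv: "weak_conv_m (\<lambda>k. \<mu> (r k)) M"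
    by (auto simp: o_def)
  interpret M: real_distribution M by fact
  have \<mu>r: "real_distribution (\<mu> (r k))" for k
    using \<mu> by (simp add: real_distribution_def real_distribution_axioms_def)
  define \<kappa> where "\<kappa> = distr M borel (max (0::real))"
  have [measurable]: "max (0::real) \<in> borel_measurable M" by simp
  show thesis
  proof
    show "prob_space \<kappa>" unfolding \<kappa>_def by (rule M.prob_space_distr) simp
    show "sets \<kappa> = sets borel" by (simp add: \<kappa>_def)
    show "AE x in \<kappa>. 0 \<le> x" unfolding \<kappa>_def by (subst AE_distr_iff) auto
    fix s :: real assume s: "s \<ge> 0"
    let ?f = "\<lambda>x::real. exp (- s * max 0 x)"
    have "(\<lambda>k. \<integral>x. ?f x \<partial>\<mu> (r k)) \<longlonglongrightarrow> (\<integral>x. ?f x \<partial>M)"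
      using s by (intro weak_conv_imp_integral_bdd_continuous_conv[OF \<mu>r M conv, where B = 1])
        (auto intro!: continuous_intros)
    moreover have "(\<integral>x. ?f x \<partial>\<mu> (r k)) = laplace_transform (\<mu> (r k)) s" for k
    proof -
      note [measurable_cong] = \<mu>(2)[of "r k"]
      show ?thesis
        unfolding laplace_transform_def
      proof (intro integral_cong_AE)
        show "AE x in \<mu> (r k). exp (- s * max 0 x) = exp (- s * x)"
          using \<mu>(3)[of "r k"] by eventually_elim simp
      qed measurable
    qed
    moreover have "(\<integral>x. ?f x \<partial>M) = laplace_transform \<kappa> s"
      unfolding laplace_transform_def \<kappa>_def by (subst integral_distr) auto
    moreover have r_lim: "(\<lambda>k. laplace_transform (\<mu> (r k)) s) \<longlonglongrightarrow> \<phi> s"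
      using LIMSEQ_subseq_LIMSEQ[OF lim[OF s] r] by (simp add: o_def)
    ultimately have "(\<lambda>k. laplace_transform (\<mu> (r k)) s) \<longlonglongrightarrow> laplace_transform \<kappa> s"
      by (simp only:)
    then show "laplace_transform \<kappa> s = \<phi> s"
      using r_lim by (rule LIMSEQ_unique)
  qed
qed

section \<open>Laws with a prescribed Levy density\<close>

text \<open>
  The law has density \<open>f\<close> on the positive half-line and the missing mass as an atom at 0. The
  atom is produced by spreading the missing mass uniformly over \<open>[-1, 0]\<close> and mapping with
  \<open>max 0\<close>; thus everything is an integral with respect to Lebesgue measure.
\<close>

lemma law_with_atom_at_0:
  fixes f :: "real \<Rightarrow> real"
  assumes f: "integrable lborel f" "\<And>x. 0 \<le> f x" "\<And>x. x \<le> 0 \<Longrightarrow> f x = 0"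
    and mass: "(\<integral>x. f x \<partial>lborel) \<le> 1"
  obtains \<mu> where "prob_space \<mu>" "sets \<mu> = sets borel" "AE x in \<mu>. 0 \<le> x"
    "\<And>s. s \<ge> 0 \<Longrightarrow> laplace_transform \<mu> s = 1 - (\<integral>x. (1 - exp (- s * x)) * f x \<partial>lborel)"
proof -
  define q where "q = (\<integral>x. f x \<partial>lborel)"
  have q: "q \<le> 1" using mass by (simp add: q_def)
  have [measurable]: "f \<in> borel_measurable borel" using f(1) by auto
  define h where "h x = f x + (1 - q) * indicator {-1..0} x" for x :: real
  have [measurable]: "h \<in> borel_measurable borel" unfolding h_def by measurable
  have h0: "h x \<ge> 0" for x using f(2) q by (auto simp: h_def)
  have ind: "integrable lborel (\<lambda>x::real. (1 - q) * indicator {-1..0} x)"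
    "(\<integral>x. (1 - q) * indicator {-1..0::real} x \<partial>lborel) = 1 - q"
    by simp_all
  have h1: "integrable lborel h" "(\<integral>x. h x \<partial>lborel) = 1"
    unfolding h_def using f(1) ind by (simp_all add: q_def)
  interpret h: prob_space "density lborel h"
  proof (rule prob_spaceI)
    have "emeasure (density lborel h) (space (density lborel h)) = (\<integral>\<^sup>+x. h x \<partial>lborel)"
      by (simp add: emeasure_density)
    also have "\<dots> = 1"
      using h1 h0 by (subst nn_integral_eq_integral) auto
    finally show "emeasure (density lborel h) (space (density lborel h)) = 1" .
  qed
  define \<mu> where "\<mu> = distr (density lborel h) borel (max (0::real))"
  have [measurable]: "max (0::real) \<in> borel_measurable borel" by simp
  show thesis
  proof
    show "prob_space \<mu>" unfolding \<mu>_def by (rule h.prob_space_distr) simp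
    show "sets \<mu> = sets borel" by (simp add: \<mu>_def)
    show "AE x in \<mu>. 0 \<le> x" unfolding \<mu>_def by (subst AE_distr_iff) auto
    fix s :: real assume s: "s \<ge> 0"
    have int: "integrable lborel (\<lambda>x. exp (- s * x) * f x)"
    proof (rule Bochner_Integration.integrable_bound[OF f(1)])
      have "exp (- s * x) * f x \<le> f x" for x
        using s f(2)[of x] f(3)[of x] by (cases "x \<le> 0") (auto intro!: mult_left_le_one_le)
      then show "AE x in lborel. norm (exp (- s * x) * f x) \<le> norm (f x)"
        using f(2) by (auto simp: abs_mult)
    qed simp
    have "laplace_transform \<mu> s = (\<integral>x. h x * exp (- s * max 0 x) \<partial>lborel)"
      unfolding laplace_transform_def \<mu>_def
      by (subst integral_distr, simp, simp, subst integral_density) (auto simp: h0)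
    also have "\<dots> = (\<integral>x. exp (- s * x) * f x + (1 - q) * indicator {-1..0} x \<partial>lborel)"
      by (intro Bochner_Integration.integral_cong) (auto simp: h_def f(3) max_def indicator_def)
    also have "\<dots> = (\<integral>x. exp (- s * x) * f x \<partial>lborel) + (1 - q)"
      using int ind by simp
    also have "\<dots> = 1 - (\<integral>x. f x - exp (- s * x) * f x \<partial>lborel)"
      using int f(1) by (simp add: q_def)
    finally show "laplace_transform \<mu> s = 1 - (\<integral>x. (1 - exp (- s * x)) * f x \<partial>lborel)"
      by (simp add: left_diff_distrib)
  qed
qed

text \<open>
  The conditions \<open>0 \<le> a k \<le> k\<close> keep the bases in \<open>[0, 1]\<close>, where \<open>k\<close>-th powers differ by at most
  \<open>k\<close> times the difference of the bases. So \<open>a k\<close> may be replaced by its limit.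
\<close>

lemma pow_one_minus_tendsto_exp:
  fixes a :: "nat \<Rightarrow> real"
  assumes a: "a \<longlonglongrightarrow> c" and c: "0 \<le> c"
    and unit: "\<And>k. 0 \<le> a k" "\<And>k. a k \<le> real k"
  shows "(\<lambda>k. (1 - a k / real k) ^ k) \<longlonglongrightarrow> exp (- c)"
proof -
  have exp_lim: "(\<lambda>k. (1 - c / real k) ^ k) \<longlonglongrightarrow> exp (- c)"
    using tendsto_exp_limit_sequentially[of "- c"] by simp
  obtain N :: nat where N: "c \<le> real N" using real_arch_simple by blast
  have "\<bar>(1 - a k / real k) ^ k - (1 - c / real k) ^ k\<bar> \<le> \<bar>a k - c\<bar>" if k: "k \<ge> Suc N" for k
  proof -
    have k0: "real k > 0" "c \<le> real k" using N k by auto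
    have "norm ((1 - a k / real k) ^ k - (1 - c / real k) ^ k)
        \<le> real k * norm ((1 - a k / real k) - (1 - c / real k))"
    proof (rule norm_power_diff)
      show "norm (1 - a k / real k) \<le> 1"
        using unit[of k] k0 by (simp add: abs_le_iff field_simps)
      show "norm (1 - c / real k) \<le> 1"
        using c k0 by (simp add: abs_le_iff field_simps)
    qed
    also have "(1 - a k / real k) - (1 - c / real k) = (c - a k) / real k"
      by (simp add: diff_divide_distrib)
    also have "real k * norm ((c - a k) / real k) = \<bar>a k - c\<bar>"
      using k0 by (simp add: abs_minus_commute)
    finally show ?thesis by simp
  qed
  then have "\<forall>\<^sub>F k in sequentially. norm ((1 - a k / real k) ^ k - (1 - c / real k) ^ k) \<le> \<bar>a k - c\<bar>"
    unfolding eventually_sequentially real_norm_def by blast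
  moreover have "(\<lambda>k. \<bar>a k - c\<bar>) \<longlonglongrightarrow> 0"
    using a by (simp add: LIM_zero tendsto_rabs_zero)
  ultimately have "(\<lambda>k. (1 - a k / real k) ^ k - (1 - c / real k) ^ k) \<longlonglongrightarrow> 0"
    by (rule Lim_null_comparison)
  from tendsto_add[OF this exp_lim] show ?thesis by simp
qed

text \<open>
  This is the existence part of the Levy-Khintchine representation for laws on the half-line
  without drift. The law is the limit of the convolution powers described at the beginning.
\<close>

lemma exists_law_with_Levy_density:
  fixes l :: "real \<Rightarrow> real"
  assumes [measurable]: "l \<in> borel_measurable borel"
    and l: "\<And>x. 0 \<le> l x" "\<And>x. x \<le> 0 \<Longrightarrow> l x = 0"
    and int: "\<And>s. s \<ge> 0 \<Longrightarrow> integrable lborel (\<lambda>x. (1 - exp (- s * x)) * l x)"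
  obtains \<kappa> where "prob_space \<kappa>" "sets \<kappa> = sets borel" "AE x in \<kappa>. 0 \<le> x"
    "\<And>s. s \<ge> 0 \<Longrightarrow> laplace_transform \<kappa> s = exp (- (\<integral>x. (1 - exp (- s * x)) * l x \<partial>lborel))"
proof -
  define \<psi> where "\<psi> s = (\<integral>x. (1 - exp (- s * x)) * l x \<partial>lborel)" for s
  have nonneg: "0 \<le> (1 - exp (- s * x)) * l x" if "s \<ge> 0" for s x
    using l[of x] that by (cases "x \<le> 0") auto
  have mono: "(1 - exp (- s * x)) * l x \<le> (1 - exp (- t * x)) * l x" if "s \<le> t" for s t x
    using l[of x] that by (cases "x \<le> 0") (auto intro!: mult_right_mono)
  \<comment> \<open>The summand 1 only makes \<open>C\<close> positive when \<open>l\<close> vanishes almost everywhere.\<close>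
  define C where "C = \<psi> 1 + 1"
  have \<psi>0: "\<psi> s \<ge> 0" if "s \<ge> 0" for s
    unfolding \<psi>_def by (intro integral_nonneg_AE AE_I2 nonneg that)
  have C: "C > 0" using \<psi>0[of 1] by (simp add: C_def)
  \<comment> \<open>The jumps that are kept at stage \<open>k\<close>: by Markov's inequality for \<open>1 - exp (- x)\<close> their
    mass is at most \<open>k\<close>, and the sets \<open>A k\<close> exhaust the positive half-line.\<close>
  define A where "A k = {x. C \<le> real k * (1 - exp (- x))}" for k
  have [measurable]: "A k \<in> sets borel" for k unfolding A_def by measurable
  define f where "f k x = indicator (A k) x * l x" for k x
  have [measurable]: "f k \<in> borel_measurable borel" for k unfolding f_def by measurable
  have f0: "0 \<le> f k x" "f k x \<le> l x" "x \<le> 0 \<Longrightarrow> f k x = 0" for k x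
    using l[of x] by (auto simp: f_def indicator_def)
  have f_le: "f k x \<le> real k / C * ((1 - exp (- 1 * x)) * l x)" for k x
  proof (cases "x \<in> A k")
    case True
    then have "1 \<le> real k / C * (1 - exp (- x))" using C by (simp add: A_def field_simps)
    from mult_right_mono[OF this l(1)[of x]] show ?thesis
      using True by (simp add: f_def mult_ac)
  next
    case False
    then show ?thesis using nonneg[of 1 x] C by (simp add: f_def)
  qed
  have f_int: "integrable lborel (f k)" for k
  proof (rule Bochner_Integration.integrable_bound)
    show "integrable lborel (\<lambda>x. real k / C * ((1 - exp (- 1 * x)) * l x))"
      using int[of 1] by (intro integrable_mult_right) simp
    have "norm (f k x) \<le> norm (real k / C * ((1 - exp (- 1 * x)) * l x))" for x
      using f0(1)[of k x] f_le[of k x] by (metis abs_ge_self abs_of_nonneg order_trans real_norm_def)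
    then show "AE x in lborel. norm (f k x) \<le> norm (real k / C * ((1 - exp (- 1 * x)) * l x))"
      by (rule AE_I2)
  qed simp
  have mass: "(\<integral>x. f k x \<partial>lborel) \<le> real k" for k
  proof -
    have "(\<integral>x. f k x \<partial>lborel) \<le> (\<integral>x. real k / C * ((1 - exp (- 1 * x)) * l x) \<partial>lborel)"
      using f_int f_le int[of 1] by (intro integral_mono) auto
    also have "\<dots> = real k * (\<psi> 1 / C)" by (simp add: \<psi>_def)
    also have "\<dots> \<le> real k * 1"
      using C by (intro mult_left_mono) (auto simp: C_def)
    finally show ?thesis by simp
  qed
  define a where "a k s = (\<integral>x. (1 - exp (- s * x)) * f k x \<partial>lborel)" for k s
  have a_int: "integrable lborel (\<lambda>x. (1 - exp (- s * x)) * f k x)" if "s \<ge> 0" for s k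
    by (rule Bochner_Integration.integrable_bound[OF int[OF that]])
      (use nonneg[OF that] in \<open>auto simp: f_def indicator_def\<close>)
  have a_bounds: "0 \<le> a k s" "a k s \<le> \<psi> s" "a k s \<le> real k" if s: "s \<ge> 0" for k s
  proof -
    show "0 \<le> a k s" unfolding a_def
      by (intro integral_nonneg_AE AE_I2) (use nonneg[OF s] in \<open>simp add: f_def indicator_def\<close>)
    show "a k s \<le> \<psi> s" unfolding a_def \<psi>_def
      using nonneg[OF s] by (intro integral_mono a_int int s) (simp add: f_def indicator_def)
    have "a k s \<le> (\<integral>x. f k x \<partial>lborel)" unfolding a_def
      using f0(1) by (intro integral_mono a_int f_int s) (simp add: mult_left_le_one_le algebra_simps)
    with mass[of k] show "a k s \<le> real k" by simp
  qed
  have a_lim: "(\<lambda>k. a k s) \<longlonglongrightarrow> \<psi> s" if s: "s \<ge> 0" for s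
    unfolding a_def \<psi>_def
  proof (rule integral_dominated_convergence[OF _ _ int[OF s]])
    show "AE x in lborel. (\<lambda>k. (1 - exp (- s * x)) * f k x) \<longlonglongrightarrow> (1 - exp (- s * x)) * l x"
    proof (rule AE_I2)
      fix x :: real
      show "(\<lambda>k. (1 - exp (- s * x)) * f k x) \<longlonglongrightarrow> (1 - exp (- s * x)) * l x"
      proof (cases "x \<le> 0")
        case True
        then show ?thesis using l(2)[of x] by (simp add: f_def)
      next
        case False
        then have e: "1 - exp (- x) > 0" by simp
        obtain N :: nat where N: "C / (1 - exp (- x)) \<le> real N" using real_arch_simple by blast
        have "f k x = l x" if "k \<ge> N" for k
        proof -
          have "C \<le> real N * (1 - exp (- x))" using N e by (simp add: pos_divide_le_eq)
          also have "\<dots> \<le> real k * (1 - exp (- x))" using that e by (intro mult_right_mono) auto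
          finally show ?thesis by (simp add: f_def A_def)
        qed
        then have "\<forall>\<^sub>F k in sequentially. (1 - exp (- s * x)) * f k x = (1 - exp (- s * x)) * l x"
          unfolding eventually_sequentially by auto
        then show ?thesis by (rule tendsto_eventually)
      qed
    qed
    show "AE x in lborel. norm ((1 - exp (- s * x)) * f k x) \<le> (1 - exp (- s * x)) * l x" for k
      using nonneg[OF s] by (auto simp: f_def indicator_def)
  qed measurable
  have "\<exists>\<mu>. prob_space \<mu> \<and> sets \<mu> = sets borel \<and> (AE x in \<mu>. 0 \<le> x) \<and>
      (\<forall>s\<ge>0. laplace_transform \<mu> s = 1 - a k s / real k)" for k
  proof -
    have "(\<integral>x. f k x / real k \<partial>lborel) \<le> 1"
      using mass[of k] by (cases "k = 0") auto
    then obtain \<mu> where \<mu>: "prob_space \<mu>" "sets \<mu> = sets borel" "AE x in \<mu>. 0 \<le> x"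
      and L: "\<And>s. s \<ge> 0 \<Longrightarrow>
        laplace_transform \<mu> s = 1 - (\<integral>x. (1 - exp (- s * x)) * (f k x / real k) \<partial>lborel)"
      using law_with_atom_at_0[of "\<lambda>x. f k x / real k"] f_int[of k] f0 by auto
    have "laplace_transform \<mu> s = 1 - a k s / real k" if "s \<ge> 0" for s
      using L[OF that] by (simp add: a_def)
    with \<mu> show ?thesis by blast
  qed
  then obtain \<mu> where \<mu>: "\<And>k. prob_space (\<mu> k)" "\<And>k. sets (\<mu> k) = sets borel"
    and \<mu>0: "\<And>k. AE x in \<mu> k. 0 \<le> x"
    and L: "\<And>k s. s \<ge> 0 \<Longrightarrow> laplace_transform (\<mu> k) s = 1 - a k s / real k"
    by metis
  \<comment> \<open>A compound binomial law, in place of the compound Poisson law of the kept jumps.\<close>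
  define \<tau> where "\<tau> k = convolution_power (\<mu> k) k" for k
  have \<tau>: "prob_space (\<tau> k)" "sets (\<tau> k) = sets borel" for k
    using convolution_power_prob_space[OF \<mu>] by (simp_all add: \<tau>_def)
  have L\<tau>: "laplace_transform (\<tau> k) s = (1 - a k s / real k) ^ k" if "s \<ge> 0" for k s
    using laplace_transform_convolution_power[OF \<mu>] L[OF that] by (simp add: \<tau>_def)
  have unit: "0 \<le> a k s / real k" "a k s / real k \<le> 1" if "s \<ge> 0" for k s
    using a_bounds[OF that, of k] by (auto simp: divide_le_eq)
  \<comment> \<open>Bernoulli's inequality gives a bound that is uniform in \<open>k\<close>, which is what tightness needs.\<close>
  have lower: "1 - \<psi> s \<le> laplace_transform (\<tau> k) s" if s: "s \<ge> 0" for k s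
  proof (cases "k = 0")
    case True
    then show ?thesis using \<psi>0[OF s] L\<tau>[OF s] by simp
  next
    case False
    have "1 - \<psi> s \<le> 1 - a k s" using a_bounds[OF s] by simp
    also have "\<dots> = 1 + real k * (- (a k s / real k))" using False by simp
    also have "\<dots> \<le> (1 + (- (a k s / real k))) ^ k"
      using unit[OF s] by (intro Bernoulli_inequality) simp
    finally show ?thesis using L\<tau>[OF s] by simp
  qed
  have lim: "(\<lambda>k. laplace_transform (\<tau> k) s) \<longlonglongrightarrow> exp (- \<psi> s)" if s: "s \<ge> 0" for s
    unfolding L\<tau>[OF s]
    using a_bounds[OF s] by (intro pow_one_minus_tendsto_exp a_lim s \<psi>0) auto
  have \<tau>0: "AE x in \<tau> k. 0 \<le> x" for k
  proof (rule AE_nonneg_of_laplace_transform_le_1[OF \<tau>])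
    fix s :: real assume s: "s \<ge> 0"
    show "laplace_transform (\<tau> k) s \<le> 1"
      using unit[OF s] L\<tau>[OF s] by (simp add: power_le_one)
    show "0 < laplace_transform (\<tau> k) s"
      using laplace_transform_bounds[OF \<mu> \<mu>0 s] laplace_transform_convolution_power[OF \<mu>]
      by (simp add: \<tau>_def)
  qed
  have \<psi>_lim: "(\<lambda>m. \<psi> (1 / real (Suc m))) \<longlonglongrightarrow> 0"
  proof -
    have "(\<lambda>m. \<integral>x. (1 - exp (- (1 / real (Suc m)) * x)) * l x \<partial>lborel) \<longlonglongrightarrow> (\<integral>x. (1 - exp (- 0 * x)) * l x \<partial>lborel)"
    proof (rule integral_dominated_convergence[OF _ _ int[of 1]])
      have "(\<lambda>m. 1 / real (Suc m)) \<longlonglongrightarrow> 0" by real_asymp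
      then show "AE x in lborel. (\<lambda>m. (1 - exp (- (1 / real (Suc m)) * x)) * l x) \<longlonglongrightarrow> (1 - exp (- 0 * x)) * l x"
        by (intro AE_I2 tendsto_intros)
      show "AE x in lborel. norm ((1 - exp (- (1 / real (Suc m)) * x)) * l x) \<le> (1 - exp (- 1 * x)) * l x" for m
        using nonneg[of "1 / real (Suc m)"] mono[of "1 / real (Suc m)" 1] by auto
    qed simp_all
    then show ?thesis by (simp add: \<psi>_def)
  qed
  from laplace_continuity[OF \<tau> \<tau>0 lower \<psi>_lim lim] show thesis
    using that unfolding \<psi>_def by blast
qed

text \<open>
  The \<open>n\<close>-th root is the law with Levy density \<open>l / n\<close>.
\<close>

lemma infinitely_divisible_of_Levy_density:
  fixes l :: "real \<Rightarrow> real"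
  assumes \<nu>: "prob_space \<nu>" "sets \<nu> = sets borel"
    and [measurable]: "l \<in> borel_measurable borel"
    and l: "\<And>x. 0 \<le> l x" "\<And>x. x \<le> 0 \<Longrightarrow> l x = 0"
    and int: "\<And>s. s \<ge> 0 \<Longrightarrow> integrable lborel (\<lambda>x. (1 - exp (- s * x)) * l x)"
    and L: "\<And>s. s \<ge> 0 \<Longrightarrow>
      laplace_transform \<nu> s = exp (- (\<integral>x. (1 - exp (- s * x)) * l x \<partial>lborel))"
  shows "infinitely_divisible \<nu>"
  unfolding infinitely_divisible_def
proof (intro conjI allI impI)
  have "0 \<le> (1 - exp (- s * x)) * l x" if "s \<ge> 0" for s x
    using l[of x] that by (cases "x \<le> 0") auto
  then have "0 \<le> (\<integral>x. (1 - exp (- s * x)) * l x \<partial>lborel)" if "s \<ge> 0" for s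
    using that by (intro integral_nonneg_AE AE_I2) auto
  then have \<nu>0: "AE x in \<nu>. 0 \<le> x"
    using L by (intro AE_nonneg_of_laplace_transform_le_1[OF \<nu>]) simp_all
  fix n :: nat assume n: "n \<ge> 1"
  have "integrable lborel (\<lambda>x. (1 - exp (- s * x)) * (l x / real n))" if "s \<ge> 0" for s
    using integrable_divide[OF int[OF that], of "real n"] by simp
  then obtain \<kappa> where \<kappa>: "prob_space \<kappa>" "sets \<kappa> = sets borel" "AE x in \<kappa>. 0 \<le> x"
    and L\<kappa>: "\<And>s. s \<ge> 0 \<Longrightarrow>
      laplace_transform \<kappa> s = exp (- (\<integral>x. (1 - exp (- s * x)) * (l x / real n) \<partial>lborel))"
    using exists_law_with_Levy_density[of "\<lambda>x. l x / real n"] l by auto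
  note \<kappa>n = convolution_power_prob_space[OF \<kappa>(1,2), of n]
  note L\<kappa>n = laplace_transform_convolution_power[OF \<kappa>(1,2), of n]
  have "AE x in convolution_power \<kappa> n. 0 \<le> x"
    using laplace_transform_bounds[OF \<kappa>]
    by (intro AE_nonneg_of_laplace_transform_le_1[OF \<kappa>n]) (simp_all add: L\<kappa>n power_le_one less_imp_le)
  moreover have "laplace_transform (convolution_power \<kappa> n) s = laplace_transform \<nu> s" if "s \<ge> 0" for s
    using n L[OF that] L\<kappa>[OF that] by (simp add: L\<kappa>n exp_of_nat_mult [symmetric])
  ultimately have "convolution_power \<kappa> n = \<nu>"
    by (intro eq_of_laplace_transform_eq[OF \<kappa>n _ \<nu> \<nu>0]) simp_all
  then show "\<exists>\<kappa>. prob_space \<kappa> \<and> sets \<kappa> = sets borel \<and> convolution_power \<kappa> n = \<nu>"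
    using \<kappa> by blast
qed (fact \<nu>)+

section \<open>The Levy density of the error term\<close>

text \<open>
  Euler's integral for \<open>Gamma (1 - \<beta>)\<close> after the substitution \<open>u = t * x\<close>.
\<close>

lemma nn_integral_powr_exp:
  assumes t: "t > 0" and \<beta>: "\<beta> < (1::real)"
  shows "(\<integral>\<^sup>+x. ennreal (indicator {0<..} x * (x powr (- \<beta>) * exp (- t * x))) \<partial>lborel)
    = ennreal (Gamma (1 - \<beta>) * t powr (\<beta> - 1))"
proof -
  let ?I = "\<integral>\<^sup>+x. ennreal (indicator {0<..} x * (x powr (- \<beta>) * exp (- t * x))) \<partial>lborel"
  have "ennreal (Gamma (1 - \<beta>))
      = (\<integral>\<^sup>+u. ennreal (indicator {0..} u * u powr (1 - \<beta> - 1) / exp u) \<partial>lborel)"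
    using \<beta> by (intro Gamma_conv_nn_integral_real) simp
  also have "\<dots> = ennreal \<bar>t\<bar> * (\<integral>\<^sup>+x. ennreal (indicator {0..} (0 + t * x)
      * (0 + t * x) powr (1 - \<beta> - 1) / exp (0 + t * x)) \<partial>lborel)"
    using t by (intro nn_integral_real_affine) auto
  also have "(\<integral>\<^sup>+x. ennreal (indicator {0..} (0 + t * x)
      * (0 + t * x) powr (1 - \<beta> - 1) / exp (0 + t * x)) \<partial>lborel)
    = (\<integral>\<^sup>+x. ennreal (t powr (- \<beta>))
        * ennreal (indicator {0<..} x * (x powr (- \<beta>) * exp (- t * x))) \<partial>lborel)"
  proof (intro nn_integral_cong)
    fix x :: real
    show "ennreal (indicator {0..} (0 + t * x) * (0 + t * x) powr (1 - \<beta> - 1) / exp (0 + t * x))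
      = ennreal (t powr (- \<beta>)) * ennreal (indicator {0<..} x * (x powr (- \<beta>) * exp (- t * x)))"
      using t by (cases "x > 0"; cases "x = 0")
        (simp_all add: ennreal_mult' [symmetric] indicator_def zero_le_mult_iff powr_mult exp_minus field_simps)
  qed
  also have "\<dots> = ennreal (t powr (- \<beta>)) * ?I" by (intro nn_integral_cmult) auto
  finally have *: "ennreal (Gamma (1 - \<beta>)) = ennreal (t powr (1 - \<beta>)) * ?I"
    using t by (simp add: mult.assoc [symmetric] ennreal_mult' [symmetric] powr_diff powr_minus divide_inverse)
  have "?I = ennreal (t powr (\<beta> - 1)) * (ennreal (t powr (1 - \<beta>)) * ?I)"
    using t by (simp add: mult.assoc [symmetric] ennreal_mult' [symmetric] powr_add [symmetric])
  also have "\<dots> = ennreal (Gamma (1 - \<beta>) * t powr (\<beta> - 1))"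
    unfolding * [symmetric] by (subst mult.commute) (simp add: ennreal_mult'' [symmetric])
  finally show ?thesis .
qed

text \<open>
  The difference of exponentials is the integral of \<open>x * exp (- t * x)\<close> over \<open>t\<close> from \<open>a\<close> to \<open>b\<close>;
  exchanging the integrals reduces the claim to the Gamma integral. The difference is what tames
  the singularity \<open>x powr (- 1 - \<beta>)\<close> at 0, which no single exponential term can be integrated
  against.
\<close>

lemma has_bochner_integral_stable_difference:
  assumes a: "0 < a" "a \<le> b" and \<beta>: "0 < \<beta>" "\<beta> < (1::real)"
  shows "has_bochner_integral lborel
    (\<lambda>x. indicator {0<..} x * (x powr (- 1 - \<beta>) * (exp (- a * x) - exp (- b * x))))
    (Gamma (1 - \<beta>) / \<beta> * (b powr \<beta> - a powr \<beta>))"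
proof (rule has_bochner_integral_nn_integral)
  let ?g = "\<lambda>x t :: real. ennreal (indicator {0<..} x * (x powr (- \<beta>) * exp (- t * x))) * indicator {a..b} t"
  have "(\<integral>\<^sup>+x. ennreal (indicator {0<..} x * (x powr (- 1 - \<beta>) * (exp (- a * x) - exp (- b * x)))) \<partial>lborel)
    = (\<integral>\<^sup>+x. \<integral>\<^sup>+t. ?g x t \<partial>lborel \<partial>lborel)"
  proof (intro nn_integral_cong)
    fix x :: real
    show "ennreal (indicator {0<..} x * (x powr (- 1 - \<beta>) * (exp (- a * x) - exp (- b * x))))
      = (\<integral>\<^sup>+t. ?g x t \<partial>lborel)"
    proof (cases "x > 0")
      case True
      have "(\<integral>\<^sup>+t. ennreal (x powr (- \<beta>) * exp (- t * x)) * indicator {a..b} t \<partial>lborel)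
        = ennreal ((- (x powr (- 1 - \<beta>)) * exp (- b * x)) - (- (x powr (- 1 - \<beta>)) * exp (- a * x)))"
      proof (intro nn_integral_FTC_Icc)
        fix t :: real
        have "x powr (- \<beta>) = x powr (- 1 - \<beta>) * x"
          using True by (simp add: powr_mult_base mult.commute)
        then show "((\<lambda>t. - (x powr (- 1 - \<beta>)) * exp (- t * x)) has_real_derivative
            x powr (- \<beta>) * exp (- t * x)) (at t)"
          by (auto intro!: derivative_eq_intros)
      qed (use a in auto)
      then show ?thesis using True by (simp add: right_diff_distrib)
    qed simp
  qed
  also have "\<dots> = (\<integral>\<^sup>+t. \<integral>\<^sup>+x. ?g x t \<partial>lborel \<partial>lborel)"
    by (intro lborel_pair.Fubini' [symmetric]) measurable
  also have "\<dots> = (\<integral>\<^sup>+t. ennreal (Gamma (1 - \<beta>) * t powr (\<beta> - 1)) * indicator {a..b} t \<partial>lborel)"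
  proof (intro nn_integral_cong)
    fix t :: real
    show "(\<integral>\<^sup>+x. ?g x t \<partial>lborel) = ennreal (Gamma (1 - \<beta>) * t powr (\<beta> - 1)) * indicator {a..b} t"
    proof (cases "t \<in> {a..b}")
      case True
      then show ?thesis using a nn_integral_powr_exp[of t \<beta>] \<beta> by simp
    qed simp
  qed
  also have "\<dots> = ennreal (Gamma (1 - \<beta>) / \<beta> * b powr \<beta> - Gamma (1 - \<beta>) / \<beta> * a powr \<beta>)"
  proof (intro nn_integral_FTC_Icc)
    fix t assume "t \<in> {a..b}"
    then show "((\<lambda>t. Gamma (1 - \<beta>) / \<beta> * t powr \<beta>) has_real_derivative
        Gamma (1 - \<beta>) * t powr (\<beta> - 1)) (at t)"
      using a \<beta> by (auto intro!: derivative_eq_intros simp: field_simps)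
    show "0 \<le> Gamma (1 - \<beta>) * t powr (\<beta> - 1)"
      using \<beta> by (simp add: Gamma_real_pos less_imp_le)
  qed (use a in auto)
  finally show "(\<integral>\<^sup>+x. ennreal (indicator {0<..} x * (x powr (- 1 - \<beta>)
      * (exp (- a * x) - exp (- b * x)))) \<partial>lborel)
    = ennreal (Gamma (1 - \<beta>) / \<beta> * (b powr \<beta> - a powr \<beta>))"
    by (simp add: right_diff_distrib)
  show "0 \<le> Gamma (1 - \<beta>) / \<beta> * (b powr \<beta> - a powr \<beta>)"
    using a \<beta> by (intro mult_nonneg_nonneg divide_nonneg_pos) (auto simp: Gamma_real_pos less_imp_le powr_mono2)
  show "AE x in lborel. 0 \<le> indicator {0<..} x * (x powr (- 1 - \<beta>) * (exp (- a * x) - exp (- b * x)))"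
    using a by (intro AE_I2) (auto simp: indicator_def intro!: mult_right_mono)
qed measurable

text \<open>
  The first term is the Levy density of the tempered stable law of \<open>X n\<close>; the second, with the same
  prefactor, is that of \<open>\<rho> * X n\<close>. For \<open>\<rho> = 0\<close> the second term vanishes because \<open>0 powr \<beta> = 0\<close>,
  whatever the value of \<open>lam / 0\<close>.
\<close>

definition error_Levy_density :: "real \<Rightarrow> real \<Rightarrow> real \<Rightarrow> real \<Rightarrow> real" where
  "error_Levy_density lam \<beta> \<rho> x = \<beta> / Gamma (1 - \<beta>) * (indicator {0<..} x *
     (x powr (- 1 - \<beta>) * (exp (- lam * x) - \<rho> powr \<beta> * exp (- (lam / \<rho>) * x))))"

lemma borel_measurable_error_Levy_density [measurable]:
  "error_Levy_density lam \<beta> \<rho> \<in> borel_measurable borel"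
  unfolding error_Levy_density_def by measurable

text \<open>
  Both factors in which the second term differs from the first are at most 1: \<open>\<rho> powr \<beta>\<close>, and a
  stronger exponential decay because \<open>lam / \<rho> \<ge> lam\<close>.
\<close>

lemma error_Levy_density_nonneg:
  assumes "lam > 0" "0 < \<beta>" "\<beta> < 1" "0 \<le> \<rho>" "\<rho> < 1"
  shows "0 \<le> error_Levy_density lam \<beta> \<rho> x"
proof -
  have "\<rho> powr \<beta> * exp (- (lam / \<rho>) * x) \<le> exp (- lam * x)" if x: "x > 0"
  proof (cases "\<rho> = 0")
    case False
    then have \<rho>: "0 < \<rho>" using assms by simp
    have "lam \<le> lam / \<rho>" using assms \<rho> by (simp add: field_simps)
    then have "lam * x \<le> lam / \<rho> * x" using x by (intro mult_right_mono) auto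
    then have "exp (- (lam / \<rho>) * x) \<le> exp (- lam * x)" by simp
    moreover have "\<rho> powr \<beta> \<le> 1" using assms \<rho> by (simp add: powr_le1)
    ultimately show ?thesis by (smt (verit) exp_gt_zero mult_left_le_one_le powr_ge_zero)
  qed simp
  then show ?thesis
    using assms by (auto simp: error_Levy_density_def indicator_def Gamma_real_pos intro!: mult_nonneg_nonneg divide_nonneg_pos)
qed

text \<open>
  Multiplying out \<open>1 - exp (- s * x)\<close> turns the integrand into the difference of two integrands of
  the form in \<open>has_bochner_integral_stable_difference\<close>, one with tempering \<open>lam\<close> and one with
  tempering \<open>lam / \<rho>\<close>; the two contributions of \<open>lam powr \<beta>\<close> cancel.
\<close>

lemma has_bochner_integral_error_Levy_density:
  assumes lam: "lam > 0" and \<beta>: "0 < \<beta>" "\<beta> < 1" and \<rho>: "0 \<le> \<rho>" and s: "s \<ge> (0::real)"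
  shows "has_bochner_integral lborel (\<lambda>x. (1 - exp (- s * x)) * error_Levy_density lam \<beta> \<rho> x)
    ((s + lam) powr \<beta> - (\<rho> * s + lam) powr \<beta>)"
proof -
  let ?c = "Gamma (1 - \<beta>) / \<beta>"
  let ?D = "\<lambda>a b x. indicator {0<..} x * (x powr (- 1 - \<beta>) * (exp (- a * x) - exp (- b * x)))"
  have G: "Gamma (1 - \<beta>) > 0" using \<beta> by (simp add: Gamma_real_pos)
  have 1: "has_bochner_integral lborel (?D lam (s + lam)) (?c * ((s + lam) powr \<beta> - lam powr \<beta>))"
    using lam s \<beta> by (intro has_bochner_integral_stable_difference) auto
  have 2: "has_bochner_integral lborel (\<lambda>x. \<rho> powr \<beta> * ?D (lam / \<rho>) (s + lam / \<rho>) x)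
      (?c * ((\<rho> * s + lam) powr \<beta> - lam powr \<beta>))"
  proof (cases "\<rho> = 0")
    case False
    then have \<rho>0: "\<rho> > 0" using \<rho> by simp
    have "has_bochner_integral lborel (\<lambda>x. \<rho> powr \<beta> * ?D (lam / \<rho>) (s + lam / \<rho>) x)
      (\<rho> powr \<beta> * (?c * ((s + lam / \<rho>) powr \<beta> - (lam / \<rho>) powr \<beta>)))"
      using lam s \<beta> \<rho>0
      by (intro has_bochner_integral_mult_right has_bochner_integral_stable_difference) auto
    moreover have "\<rho> powr \<beta> * (s + lam / \<rho>) powr \<beta> = (\<rho> * s + lam) powr \<beta>"
      using lam s \<rho>0 by (subst powr_mult [symmetric]) (auto simp: distrib_left)
    moreover have "\<rho> powr \<beta> * (lam / \<rho>) powr \<beta> = lam powr \<beta>"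
      using lam \<rho>0 by (subst powr_mult [symmetric]) auto
    moreover have "\<rho> powr \<beta> * (?c * (u - v)) = ?c * (\<rho> powr \<beta> * u - \<rho> powr \<beta> * v)" for u v
      by (simp only: algebra_simps)
    ultimately show ?thesis by (simp only:)
  qed (use \<beta> in \<open>simp add: has_bochner_integral_zero\<close>)
  have "has_bochner_integral lborel
      (\<lambda>x. inverse ?c * (?D lam (s + lam) x - \<rho> powr \<beta> * ?D (lam / \<rho>) (s + lam / \<rho>) x))
      (inverse ?c * (?c * ((s + lam) powr \<beta> - lam powr \<beta>)
        - ?c * ((\<rho> * s + lam) powr \<beta> - lam powr \<beta>)))"
    by (intro has_bochner_integral_mult_right has_bochner_integral_diff 1 2)
  also have "(\<lambda>x. inverse ?c * (?D lam (s + lam) x - \<rho> powr \<beta> * ?D (lam / \<rho>) (s + lam / \<rho>) x))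
      = (\<lambda>x. (1 - exp (- s * x)) * error_Levy_density lam \<beta> \<rho> x)"
  proof
    fix x
    have "exp (- (s + a) * x) = exp (- s * x) * exp (- a * x)" for a
      by (simp add: exp_add [symmetric] algebra_simps)
    then show "inverse ?c * (?D lam (s + lam) x - \<rho> powr \<beta> * ?D (lam / \<rho>) (s + lam / \<rho>) x)
      = (1 - exp (- s * x)) * error_Levy_density lam \<beta> \<rho> x"
      by (simp only: error_Levy_density_def inverse_divide) (simp only: algebra_simps)
  qed
  also have "inverse ?c * (?c * ((s + lam) powr \<beta> - lam powr \<beta>)
      - ?c * ((\<rho> * s + lam) powr \<beta> - lam powr \<beta>)) = (s + lam) powr \<beta> - (\<rho> * s + lam) powr \<beta>"
  proof -
    have "inverse c * (c * u - c * v) = u - v" if "c \<noteq> 0" for c u v :: real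
      using that by (simp add: field_simps)
    from this[of ?c] show ?thesis using G \<beta> by simp
  qed
  finally show ?thesis .
qed

section \<open>The sign of the autoregression coefficient\<close>

text \<open>
  Suppose \<open>\<rho> = - r < 0\<close> and let \<open>s0 = lam / r\<close>. Convexity of the Laplace transform on \<open>[0, s0]\<close>
  bounds its decrease from \<open>s0 - h\<close> to \<open>s0\<close> by \<open>h / s0\<close>, whereas the term \<open>(lam - r * s) powr \<beta>\<close>
  forces a decrease of at least a positive constant times \<open>h powr \<beta>\<close>. For small \<open>h\<close> this is
  impossible because \<open>\<beta> < 1\<close>.
\<close>

lemma nonneg_of_error_laplace_transform:
  assumes lam: "lam > 0" and \<beta>: "0 < \<beta>" "\<beta> < 1"
    and "prob_space \<nu>" and [measurable_cong]: "sets \<nu> = sets borel"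
    and L: "\<And>s. s \<ge> 0 \<Longrightarrow> \<rho> * s + lam \<ge> 0 \<Longrightarrow>
      laplace_transform \<nu> s = exp ((\<rho> * s + lam) powr \<beta> - (s + lam) powr \<beta>)"
  shows "0 \<le> (\<rho>::real)"
proof (rule ccontr)
  interpret prob_space \<nu> by fact
  assume "\<not> 0 \<le> \<rho>"
  define r where "r = - \<rho>"
  have r: "r > 0" using \<open>\<not> 0 \<le> \<rho>\<close> by (simp add: r_def)
  define s0 where "s0 = lam / r"
  have s0: "s0 > 0" "r * s0 = lam" using lam r by (simp_all add: s0_def)
  have L': "laplace_transform \<nu> s = exp ((lam - r * s) powr \<beta> - (s + lam) powr \<beta>)"
    if "0 \<le> s" "s \<le> s0" for s
  proof -
    have "r * s \<le> lam" using mult_left_mono[of s s0 r] that r s0 by simp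
    then show ?thesis using L[of s] that by (simp add: r_def add.commute)
  qed
  have int: "integrable \<nu> (\<lambda>x. exp (- s * x))" if "0 \<le> s" "s \<le> s0" for s
    using L'[OF that] exp_gt_zero not_integrable_integral_eq
    unfolding laplace_transform_def by fastforce
  define E where "E = exp (- ((s0 + lam) powr \<beta>))"
  have E: "E > 0" "laplace_transform \<nu> s0 = E" "laplace_transform \<nu> 0 = 1"
    using L'[of s0] L'[of 0] s0 lam by (simp_all add: E_def)
  have bound: "r powr \<beta> * E * s0 \<le> h powr (1 - \<beta>)" if h: "0 < h" "h < s0" for h
  proof -
    \<comment> \<open>The point \<open>s0 - h\<close> is the convex combination of 0 and \<open>s0\<close> with weights \<open>u\<close> and \<open>1 - u\<close>.\<close>
    define u where "u = h / s0"
    have u: "0 \<le> u" "u \<le> 1" "u * s0 = h" using h by (simp_all add: u_def)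
    have "laplace_transform \<nu> (s0 - h) \<le> (\<integral>x. u * exp (- 0 * x) + (1 - u) * exp (- s0 * x) \<partial>\<nu>)"
      unfolding laplace_transform_def
    proof (intro integral_mono)
      fix x
      have "exp ((1 - (1 - u)) *\<^sub>R (- 0 * x) + (1 - u) *\<^sub>R (- s0 * x))
          \<le> (1 - (1 - u)) * exp (- 0 * x) + (1 - u) * exp (- s0 * x)"
        using u by (intro convex_onD[OF exp_convex]) auto
      moreover have "(1 - (1 - u)) *\<^sub>R (- 0 * x) + (1 - u) *\<^sub>R (- s0 * x) = - (s0 - h) * x"
        unfolding u(3) [symmetric] by (simp add: algebra_simps)
      ultimately show "exp (- (s0 - h) * x) \<le> u * exp (- 0 * x) + (1 - u) * exp (- s0 * x)"
        by simp
    qed (use int[of 0] int[of s0] int[of "s0 - h"] s0 h in auto)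
    also have "\<dots> = u * laplace_transform \<nu> 0 + (1 - u) * laplace_transform \<nu> s0"
      using int[of 0] int[of s0] s0 unfolding laplace_transform_def by simp
    also have "\<dots> \<le> u + E" using E u by (simp add: algebra_simps)
    finally have upper: "laplace_transform \<nu> (s0 - h) \<le> u + E" .
    have "(1 + (r * h) powr \<beta>) * E \<le> exp ((r * h) powr \<beta>) * E"
      using E by (intro mult_right_mono) auto
    also have "\<dots> = exp ((r * h) powr \<beta> - (s0 + lam) powr \<beta>)"
      by (simp add: E_def exp_add [symmetric])
    also have "\<dots> \<le> exp ((r * h) powr \<beta> - (s0 - h + lam) powr \<beta>)"
      using h lam \<beta> by (simp add: powr_mono2)
    also have "\<dots> = laplace_transform \<nu> (s0 - h)"
    proof -
      have "lam - r * (s0 - h) = r * h" using s0 by (simp add: right_diff_distrib)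
      then show ?thesis using L'[of "s0 - h"] h by simp
    qed
    finally have "(r * h) powr \<beta> * E \<le> u" using upper by (simp add: distrib_right)
    then have "(r * h) powr \<beta> * E * s0 \<le> h" using mult_right_mono[of _ u s0] u s0 by fastforce
    then have "r powr \<beta> * E * s0 * h powr \<beta> \<le> h powr (1 - \<beta>) * h powr \<beta>"
      using r h by (simp add: powr_mult powr_add [symmetric] mult_ac)
    then show ?thesis using h by simp
  qed
  have "((\<lambda>h. h powr (1 - \<beta>)) \<longlongrightarrow> 0) (at_right 0)"
    using \<beta> by real_asymp
  moreover have "\<forall>\<^sub>F h in at_right 0. r powr \<beta> * E * s0 \<le> h powr (1 - \<beta>)"
    using s0 bound by (auto simp: eventually_at_right_field)
  ultimately have "r powr \<beta> * E * s0 \<le> 0"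
    by (rule tendsto_lowerbound) simp
  moreover have "r powr \<beta> * E * s0 > 0" using r E s0 by simp
  ultimately show False by simp
qed

section \<open>The error law\<close>

theorem proposition2p1:
  fixes M :: "'a measure"
    and X eps :: "nat \<Rightarrow> 'a \<Rightarrow> real"
    and \<nu> :: "real measure"
    and lam \<beta> \<rho> :: real
  assumes "lam > 0" and "0 < \<beta>" and "\<beta> < 1" and "\<bar>\<rho>\<bar> < 1"
    and model: "stationary_AR1 M \<rho> X eps \<nu>"
    and marginals: "\<And>n. positive_tempered_stable lam \<beta> (distr M borel (X n))"
    and error_laplace: "\<And>s. s \<ge> 0 \<Longrightarrow> \<rho> * s + lam \<ge> 0 \<Longrightarrow>
      laplace_transform \<nu> s = exp ((\<rho> * s + lam) powr \<beta> - (s + lam) powr \<beta>)"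
  shows "infinitely_divisible \<nu>"
proof -
  interpret stationary_AR1 M \<rho> X eps \<nu> by (fact model)
  have "random_variable borel (eps 1)"
    using eps_indep by (auto simp: indep_vars_def)
  then have \<nu>: "prob_space \<nu>" "sets \<nu> = sets borel"
    using prob_space_distr[of "eps 1" borel] eps_law[of 1] by auto
  have \<rho>: "0 \<le> \<rho>" "\<rho> < 1"
    using nonneg_of_error_laplace_transform[OF assms(1-3) \<nu> error_laplace] \<open>\<bar>\<rho>\<bar> < 1\<close> by auto
  note psi = has_bochner_integral_error_Levy_density[OF assms(1-3) \<rho>(1)]
  show ?thesis
  proof (rule infinitely_divisible_of_Levy_density[OF \<nu> borel_measurable_error_Levy_density])
    show "0 \<le> error_Levy_density lam \<beta> \<rho> x" for x
      using error_Levy_density_nonneg[OF assms(1-3) \<rho>] .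
    show "error_Levy_density lam \<beta> \<rho> x = 0" if "x \<le> 0" for x
      using that by (simp add: error_Levy_density_def)
    fix s :: real assume s: "s \<ge> 0"
    show "integrable lborel (\<lambda>x. (1 - exp (- s * x)) * error_Levy_density lam \<beta> \<rho> x)"
      using psi[OF s] by (rule integrable.intros)
    have "\<rho> * s + lam \<ge> 0" using s \<rho> \<open>lam > 0\<close> by simp
    then show "laplace_transform \<nu> s
        = exp (- (\<integral>x. (1 - exp (- s * x)) * error_Levy_density lam \<beta> \<rho> x \<partial>lborel))"
      using error_laplace[OF s] has_bochner_integral_integral_eq[OF psi[OF s]] by simp
  qed
qed

end
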